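(* Let $n\in\mathbb{N}$ and $m\in\mathbb{N}_0$. For every nonempty subset $J\subseteq \mathcal{Z}_n$ one has $$\mathcal{H}_m(J)=(-1)^{\{m\}_n}\,\mathcal{E}_{\{m\}_n}(\mathcal{Z}_n\setminus J),$$ where $\{m\}_n$ denotes the remainder of the division of $m$ by $n$.
   Context: $\mathbb{N}=\{1,2,\ldots\}$, $\mathbb{N}_0=\mathbb{N}\cup\{0\}$. $\zeta_n:=e^{2\pi i/n}$ and $\mathcal{Z}_n:=\{1,\zeta_n,\ldots,\zeta_n^{n-1}\}$ is the set of $n$th roots of unity in $\mathbb{C}$. For complex numbers $z_1,\ldots,z_r$ (not necessarily distinct, $r\ge1$) the elementary symmetric polynomials are $\mathcal{E}_0:=1$, $\mathcal{E}_m(z_1,\ldots,z_r):=\sum_{1\le j_1<\cdots<j_m\le r}z_{j_1}\cdots z_{j_m}$ for $1\le m\le r$, and $\mathcal{E}_m:=0$ for $m>r$; the complete homogeneous symmetric polynomials are $\mathcal{H}_0:=1$ and $\mathcal{H}_m(z_1,\ldots,z_r):=\sum_{1\le j_1\le\cdots\le j_m\le r}z_{j_1}\cdots z_{j_m}$ for $m\ge1$. By symmetry, $\mathcal{E}_m(A)$ and $\mathcal{H}_m(A)$ are defined for any finite (multi)set $A=\{z_1,\ldots,z_r\}$ of complex numbers. Convention: $\mathcal{H}_m(\emptyset)=\mathcal{E}_m(\emptyset):=1$ if $m=0$ and $:=0$ otherwise. *)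

theory Defs
  imports "HOL-Analysis.Analysis" "HOL-Library.Multiset" "HOL-Combinatorics.Permutations"
begin

definition zeta :: "nat \<Rightarrow> complex" where
  "zeta n = exp (2 * complex_of_real pi * \<i> / of_nat n)"

definition unity_roots :: "nat \<Rightarrow> complex set" where
  "unity_roots n = (\<lambda>k. zeta n ^ k) ` {..<n}"

text \<open>
  A finite sequence $z_1, \ldots, z_r$ is a list, indexed from 0, and an index tuple
  $(j_1, \ldots, j_m)$ is a list of indices of length $m$.  The tuples are strictly increasing
  for the elementary symmetric polynomials and weakly increasing for the complete homogeneous
  ones.  No separate clauses are needed for the degenerate cases: for $m = 0$ the only tuple is
  the empty one, with product 1; and there is no tuple at all if $r = 0 < m$, or (in the strict
  case) if $m > r$, so that the sum is 0.
\<close>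

definition elem_sym_list :: "nat \<Rightarrow> complex list \<Rightarrow> complex" where
  "elem_sym_list m zs =
     (\<Sum>js | length js = m \<and> set js \<subseteq> {..<length zs} \<and> sorted_wrt (<) js. \<Prod>j\<leftarrow>js. zs ! j)"

definition complete_sym_list :: "nat \<Rightarrow> complex list \<Rightarrow> complex" where
  "complete_sym_list m zs =
     (\<Sum>js | length js = m \<and> set js \<subseteq> {..<length zs} \<and> sorted_wrt (\<le>) js. \<Prod>j\<leftarrow>js. zs ! j)"

text \<open>
  For a finite multiset the polynomials are evaluated at an arbitrary enumeration; the lemmas
  \<open>elem_sym_mset\<close> and \<open>complete_sym_mset\<close> below show that the choice is irrelevant.  A finite
  set \<open>A\<close> is passed as \<open>mset_set A\<close>.
\<close>

definition elem_sym :: "nat \<Rightarrow> complex multiset \<Rightarrow> complex" where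
  "elem_sym m A = elem_sym_list m (SOME zs. mset zs = A)"

definition complete_sym :: "nat \<Rightarrow> complex multiset \<Rightarrow> complex" where
  "complete_sym m A = complete_sym_list m (SOME zs. mset zs = A)"

lemma elem_sym_list_altdef:
  "elem_sym_list m zs = (\<Sum>S | S \<subseteq> {..<length zs} \<and> card S = m. \<Prod>j\<in>S. zs ! j)"
  unfolding elem_sym_list_def
proof (rule sum.reindex_bij_witness[where i = sorted_list_of_set and j = set], goal_cases)
  case (1 js)
  then show ?case
    by (simp add: sorted_list_of_set.idem_if_sorted_distinct strict_sorted_iff)
next
  case (2 js)
  then show ?case
    by (simp add: strict_sorted_iff distinct_card)
next
  case (3 S)
  then show ?case
    using finite_subset by fastforce
next
  case (4 S)
  then have "finite S" using finite_subset by blast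
  with 4 show ?case by simp
next
  case (5 js)
  then show ?case
    by (simp add: strict_sorted_iff prod.distinct_set_conv_list)
qed

lemma complete_sym_list_altdef:
  "complete_sym_list m zs =
     (\<Sum>M | set_mset M \<subseteq> {..<length zs} \<and> size M = m. \<Prod>j\<in>#M. zs ! j)"
  unfolding complete_sym_list_def
proof (rule sum.reindex_bij_witness[where i = sorted_list_of_multiset and j = mset], goal_cases)
  case (1 js)
  then show ?case
    by (simp add: sort_key_id_if_sorted sorted_sort_id)
next
  case (4 M)
  then show ?case
    by (metis (mono_tags, lifting) mem_Collect_eq mset_sorted_list_of_multiset set_mset_mset
        size_mset sorted_sorted_list_of_multiset)
qed (auto simp flip: mset_map prod_mset_prod_list)

lemma elem_sym_list_cong:
  assumes "mset xs = mset ys"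
  shows "elem_sym_list m xs = elem_sym_list m ys"
proof -
  from assms obtain p where p: "p permutes {..<length ys}" "permute_list p ys = xs"
    by (rule mset_eq_permutation)
  have len: "length xs = length ys" using p by auto
  show ?thesis
    unfolding elem_sym_list_altdef len
  proof (rule sum.reindex_bij_witness[where i = "\<lambda>S. inv p ` S" and j = "\<lambda>S. p ` S"], goal_cases)
    case (2 S)
    then show ?case
      using permutes_in_image[OF p(1)] permutes_inj_on[OF p(1)] by (auto simp: card_image)
  next
    case (4 S)
    then show ?case
      using permutes_in_image[OF permutes_inv[OF p(1)]] permutes_inj_on[OF permutes_inv[OF p(1)]]
      by (auto simp: card_image)
  next
    case (5 S)
    then show ?case
      using permutes_inj_on[OF p(1)] p
      by (subst prod.reindex) (auto simp: permute_list_nth intro!: prod.cong)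
  qed (use permutes_inverses[OF p(1)] in \<open>auto simp: image_image\<close>)
qed

lemma complete_sym_list_cong:
  assumes "mset xs = mset ys"
  shows "complete_sym_list m xs = complete_sym_list m ys"
proof -
  from assms obtain p where p: "p permutes {..<length ys}" "permute_list p ys = xs"
    by (rule mset_eq_permutation)
  have len: "length xs = length ys" using p by auto
  show ?thesis
    unfolding complete_sym_list_altdef len
  proof (rule sum.reindex_bij_witness
      [where i = "\<lambda>M. image_mset (inv p) M" and j = "\<lambda>M. image_mset p M"], goal_cases)
    case (2 M)
    then show ?case
      using permutes_in_image[OF p(1)] by auto
  next
    case (4 M)
    then show ?case
      using permutes_in_image[OF permutes_inv[OF p(1)]] by auto
  next
    case (5 M)
    then have "image_mset (\<lambda>j. ys ! p j) M = image_mset (\<lambda>j. xs ! j) M"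
      using p by (intro image_mset_cong) (auto simp: permute_list_nth)
    then show ?case
      by (simp add: image_mset.compositionality o_def)
  qed (use permutes_inverses[OF p(1)] in \<open>auto simp: image_mset.compositionality o_def\<close>)
qed

lemma elem_sym_mset: "elem_sym m (mset zs) = elem_sym_list m zs"
  unfolding elem_sym_def by (rule elem_sym_list_cong, rule someI[where x = zs]) simp

lemma complete_sym_mset: "complete_sym m (mset zs) = complete_sym_list m zs"
  unfolding complete_sym_def by (rule complete_sym_list_cong, rule someI[where x = zs]) simp

end

theory Submission
  imports Defs "HOL-Computational_Algebra.Polynomial_FPS"
begin

text \<open>
  Let \<open>J\<^sup>c\<close> be the complement of \<open>J\<close> in the set of \<open>n\<close>-th roots of unity.  The generating
  function \<open>\<Sum>\<^sub>m \<H>\<^sub>m(J) X\<^sup>m\<close> is the inverse of \<open>\<Prod>\<^sub>z\<^sub>\<in>\<^sub>J (1 - z X)\<close>, and the product of \<open>1 - z X\<close> over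
  all \<open>n\<close>-th roots of unity is \<open>1 - X\<^sup>n\<close>.  Hence \<open>(1 - X\<^sup>n) \<Sum>\<^sub>m \<H>\<^sub>m(J) X\<^sup>m\<close> is the product of
  \<open>1 - z X\<close> over \<open>J\<^sup>c\<close>, which has degree less than \<open>n\<close> and coefficients \<open>(-1)\<^sup>m \<E>\<^sub>m(J\<^sup>c)\<close>.  So
  \<open>m \<mapsto> \<H>\<^sub>m(J)\<close> has period \<open>n\<close> and agrees with these coefficients for \<open>m < n\<close>.
\<close>

section \<open>Initial values and recurrences of the symmetric polynomials\<close>

lemma elem_sym_0: "elem_sym 0 A = 1"
proof -
  obtain zs where zs: "mset zs = A" by (metis ex_mset)
  have "{S. S \<subseteq> {..<length zs} \<and> card S = 0} = {{}}"
    using finite_subset by fastforce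
  then show ?thesis
    by (simp add: elem_sym_mset elem_sym_list_altdef flip: zs)
qed

lemma elem_sym_eq_0:
  assumes "size A < m"
  shows "elem_sym m A = 0"
proof -
  obtain zs where zs: "mset zs = A" by (metis ex_mset)
  have "card S \<noteq> m" if "S \<subseteq> {..<length zs}" for S
    using card_mono[OF _ that] assms zs by auto
  then have empty: "{S. S \<subseteq> {..<length zs} \<and> card S = m} = {}"
    by blast
  show ?thesis
    using elem_sym_mset[of m zs] by (simp add: zs elem_sym_list_altdef empty)
qed

text \<open>An analogue of Pascal's rule: the index sets are split by whether they contain the index
  of \<open>z\<close>.\<close>

lemma elem_sym_Suc_add_mset:
  "elem_sym (Suc m) (add_mset z A) = elem_sym (Suc m) A + z * elem_sym m A"
proof -
  obtain zs where zs: "mset zs = A" by (metis ex_mset)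
  \<comment> \<open>\<open>z\<close> is appended at the end, so \<open>r\<close> is its index in
    \<open>zs @ [z]\<close> and the indices of \<open>zs\<close> stay unchanged.\<close>
  define r where "r = length zs"
  define F where "F k = {S. S \<subseteq> {..<r} \<and> card S = k}" for k
  have fin: "finite (F k)" for k
    unfolding F_def by (rule finite_subset[of _ "Pow {..<r}"]) auto
  have F: "finite S" "r \<notin> S" if "S \<in> F k" for S k
    using that finite_subset unfolding F_def by auto
  have split: "{S. S \<subseteq> {..<Suc r} \<and> card S = Suc m} = F (Suc m) \<union> insert r ` F m" (is "?L = ?R")
  proof
    show "?L \<subseteq> ?R"
    proof
      fix S assume S: "S \<in> ?L"
      then have finS: "finite S" using finite_subset by auto
      show "S \<in> ?R"
      proof (cases "r \<in> S")
        case True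
        with S finS have "S - {r} \<in> F m" by (auto simp: F_def)
        moreover have "S = insert r (S - {r})" using True by auto
        ultimately show ?thesis by blast
      next
        case False
        with S have "S \<subseteq> {..<r}" by (auto simp: less_Suc_eq)
        with S show ?thesis by (auto simp: F_def)
      qed
    qed
    show "?R \<subseteq> ?L"
      using F by (auto simp: F_def less_Suc_eq)
  qed
  have prod_eq: "(\<Prod>j\<in>S. (zs @ [z]) ! j) = (\<Prod>j\<in>S. zs ! j)" if "S \<in> F k" for S k
    using that by (intro prod.cong) (auto simp: F_def r_def nth_append)
  have inj: "inj_on (insert r) (F m)"
    using F(2) by (metis (no_types, lifting) inj_onI insert_ident)
  have "(\<Sum>S\<in>insert r ` F m. \<Prod>j\<in>S. (zs @ [z]) ! j) = (\<Sum>S\<in>F m. z * (\<Prod>j\<in>S. zs ! j))"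
    unfolding sum.reindex[OF inj] o_def
  proof (rule sum.cong[OF refl])
    fix S assume S: "S \<in> F m"
    then have "(\<Prod>j\<in>insert r S. (zs @ [z]) ! j) = (zs @ [z]) ! r * (\<Prod>j\<in>S. (zs @ [z]) ! j)"
      using F by simp
    then show "(\<Prod>j\<in>insert r S. (zs @ [z]) ! j) = z * (\<Prod>j\<in>S. zs ! j)"
      unfolding prod_eq[OF S] by (simp add: r_def)
  qed
  moreover have "(\<Sum>S\<in>F (Suc m). \<Prod>j\<in>S. (zs @ [z]) ! j) = (\<Sum>S\<in>F (Suc m). \<Prod>j\<in>S. zs ! j)"
    by (rule sum.cong[OF refl prod_eq])
  moreover have "F (Suc m) \<inter> insert r ` F m = {}"
    using F by auto
  ultimately have "elem_sym_list (Suc m) (zs @ [z]) =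
      (\<Sum>S\<in>F (Suc m). \<Prod>j\<in>S. zs ! j) + z * (\<Sum>S\<in>F m. \<Prod>j\<in>S. zs ! j)"
    using fin split
    by (simp add: elem_sym_list_altdef sum.union_disjoint sum_distrib_left flip: r_def)
  then have "elem_sym_list (Suc m) (zs @ [z]) = elem_sym_list (Suc m) zs + z * elem_sym_list m zs"
    by (simp add: elem_sym_list_altdef F_def r_def)
  then show ?thesis
    by (simp flip: elem_sym_mset add: zs)
qed

lemma complete_sym_0: "complete_sym 0 A = 1"
proof -
  obtain zs where zs: "mset zs = A" by (metis ex_mset)
  have "{M. set_mset M \<subseteq> {..<length zs} \<and> size M = 0} = {{#}}"
    by auto
  then show ?thesis
    by (simp add: complete_sym_mset complete_sym_list_altdef flip: zs)
qed

lemma complete_sym_empty: "complete_sym (Suc m) {#} = 0"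
proof -
  have empty: "{M :: nat multiset. set_mset M \<subseteq> {..<length []} \<and> size M = Suc m} = {}"
    by auto
  show ?thesis
    \<comment> \<open>Reading \<open>{#}\<close> as \<open>mset []\<close> makes
      \<open>complete_sym_mset\<close> applicable.\<close>
    unfolding mset.simps(1)[symmetric] complete_sym_mset complete_sym_list_altdef empty by simp
qed

text \<open>The index multisets are split by whether they contain the index of \<open>z\<close>.
  Removing one copy may leave further ones, so the last term again involves
  \<open>add_mset z A\<close>, unlike in the elementary case.\<close>

lemma complete_sym_Suc_add_mset:
  "complete_sym (Suc m) (add_mset z A) =
     complete_sym (Suc m) A + z * complete_sym m (add_mset z A)"
proof -
  obtain zs where zs: "mset zs = A" by (metis ex_mset)
  define r where "r = length zs"
  define F where "F R k = {M. set_mset M \<subseteq> {..<R} \<and> size M = k}" for R k :: nat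
  have fin: "finite (F R k)" for R k
  proof (rule finite_subset)
    show "F R k \<subseteq> mset ` {xs. set xs \<subseteq> {..<R} \<and> length xs = k}"
    proof
      fix M assume "M \<in> F R k"
      moreover obtain xs where "mset xs = M" by (metis ex_mset)
      ultimately show "M \<in> mset ` {xs. set xs \<subseteq> {..<R} \<and> length xs = k}"
        by (auto simp: F_def)
    qed
  qed (simp add: finite_lists_length_eq)
  have split: "F (Suc r) (Suc m) = F r (Suc m) \<union> add_mset r ` F (Suc r) m" (is "?L = ?R")
  proof
    show "?L \<subseteq> ?R"
    proof
      fix M assume M: "M \<in> ?L"
      show "M \<in> ?R"
      proof (cases "r \<in># M")
        case True
        then obtain N where "M = add_mset r N" by (metis mset_add)
        with M show ?thesis by (auto simp: F_def)
      next
        case False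
        with M have "set_mset M \<subseteq> {..<r}" by (auto simp: F_def less_Suc_eq)
        with M show ?thesis by (auto simp: F_def)
      qed
    qed
    show "?R \<subseteq> ?L"
      by (auto simp: F_def less_Suc_eq)
  qed
  have "(\<Sum>M\<in>add_mset r ` F (Suc r) m. \<Prod>j\<in>#M. (zs @ [z]) ! j) =
      z * (\<Sum>M\<in>F (Suc r) m. \<Prod>j\<in>#M. (zs @ [z]) ! j)"
    by (subst sum.reindex) (auto simp: inj_on_def sum_distrib_left r_def)
  moreover have "(\<Sum>M\<in>F r (Suc m). \<Prod>j\<in>#M. (zs @ [z]) ! j) = (\<Sum>M\<in>F r (Suc m). \<Prod>j\<in>#M. zs ! j)"
  proof (rule sum.cong[OF refl])
    fix M assume "M \<in> F r (Suc m)"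
    then have "image_mset (\<lambda>j. (zs @ [z]) ! j) M = image_mset (\<lambda>j. zs ! j) M"
      by (intro image_mset_cong) (auto simp: F_def r_def nth_append)
    then show "(\<Prod>j\<in>#M. (zs @ [z]) ! j) = (\<Prod>j\<in>#M. zs ! j)"
      by simp
  qed
  moreover have "F r (Suc m) \<inter> add_mset r ` F (Suc r) m = {}"
    by (auto simp: F_def)
  ultimately have "(\<Sum>M\<in>F (Suc r) (Suc m). \<Prod>j\<in>#M. (zs @ [z]) ! j) =
      (\<Sum>M\<in>F r (Suc m). \<Prod>j\<in>#M. zs ! j) + z * (\<Sum>M\<in>F (Suc r) m. \<Prod>j\<in>#M. (zs @ [z]) ! j)"
    using fin by (simp add: split sum.union_disjoint)
  then have "complete_sym_list (Suc m) (zs @ [z]) =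
      complete_sym_list (Suc m) zs + z * complete_sym_list m (zs @ [z])"
    by (simp add: complete_sym_list_altdef F_def r_def)
  then show ?thesis
    by (simp flip: complete_sym_mset add: zs)
qed

section \<open>Generating functions\<close>

text \<open>With the signs included, \<open>elem_sym_Suc_add_mset\<close> says coefficientwise that
  adding \<open>z\<close> multiplies the series by \<open>1 - fps_const z * fps_X\<close>.\<close>

lemma elem_sym_generating_function:
  "Abs_fps (\<lambda>m. (-1) ^ m * elem_sym m A) = (\<Prod>z\<in>#A. 1 - fps_const z * fps_X)"
proof (induction A)
  case empty
  show ?case
  proof (rule fps_ext)
    fix m
    show "fps_nth (Abs_fps (\<lambda>m. (-1) ^ m * elem_sym m {#})) m =
        fps_nth (\<Prod>z\<in>#{#}. 1 - fps_const z * fps_X) m"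
      by (cases m) (simp_all add: elem_sym_0 elem_sym_eq_0)
  qed
next
  case (add z A)
  have "Abs_fps (\<lambda>m. (-1) ^ m * elem_sym m (add_mset z A)) =
      (1 - fps_const z * fps_X) * Abs_fps (\<lambda>m. (-1) ^ m * elem_sym m A)"
  proof (rule fps_ext)
    fix m
    show "fps_nth (Abs_fps (\<lambda>m. (-1) ^ m * elem_sym m (add_mset z A))) m =
        fps_nth ((1 - fps_const z * fps_X) * Abs_fps (\<lambda>m. (-1) ^ m * elem_sym m A)) m"
      by (cases m)
        (simp_all add: elem_sym_0 elem_sym_Suc_add_mset left_diff_distrib distrib_left mult.assoc)
  qed
  with add.IH show ?case by simp
qed

text \<open>By \<open>complete_sym_Suc_add_mset\<close>, multiplying by
  \<open>1 - fps_const z * fps_X\<close> removes \<open>z\<close> from the multiset. The product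
  form avoids inverses of power series.\<close>

lemma complete_sym_generating_function:
  "(\<Prod>z\<in>#A. 1 - fps_const z * fps_X) * Abs_fps (\<lambda>m. complete_sym m A) = 1"
proof (induction A)
  case empty
  have "Abs_fps (\<lambda>m. complete_sym m {#}) = 1"
  proof (rule fps_ext)
    fix m
    show "fps_nth (Abs_fps (\<lambda>m. complete_sym m {#})) m = fps_nth 1 m"
      by (cases m) (simp_all add: complete_sym_0 complete_sym_empty)
  qed
  then show ?case by simp
next
  case (add z A)
  have "(1 - fps_const z * fps_X) * Abs_fps (\<lambda>m. complete_sym m (add_mset z A)) =
      Abs_fps (\<lambda>m. complete_sym m A)"
  proof (rule fps_ext)
    fix m
    show "fps_nth ((1 - fps_const z * fps_X) * Abs_fps (\<lambda>m. complete_sym m (add_mset z A))) m =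
        fps_nth (Abs_fps (\<lambda>m. complete_sym m A)) m"
      by (cases m)
        (simp_all add: complete_sym_0 complete_sym_Suc_add_mset left_diff_distrib mult.assoc)
  qed
  \<comment> \<open>The factor of \<open>z\<close> stands on the right, next to the series that it
    reduces.\<close>
  moreover have "(\<Prod>z\<in>#add_mset z A. 1 - fps_const z * fps_X) =
      (\<Prod>z\<in>#A. 1 - fps_const z * fps_X) * (1 - fps_const z * fps_X)"
    by simp
  ultimately show ?case
    using add.IH by (simp only: mult.assoc)
qed

section \<open>The product over all roots of unity\<close>

lemma unity_roots_eq:
  assumes "n \<ge> 1"
  shows "unity_roots n = {z. z ^ n = 1}" "card (unity_roots n) = n"
proof -
  have bij: "bij_betw (\<lambda>k. cis (2 * pi * real k / real n)) {..<n} {z. z ^ n = 1}"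
    using assms by (intro Complex.bij_betw_roots_unity) simp
  have "zeta n ^ k = cis (2 * pi * real k / real n)" for k
    by (simp add: zeta_def cis_conv_exp field_simps flip: exp_of_nat_mult)
  then have eq: "unity_roots n = (\<lambda>k. cis (2 * pi * real k / real n)) ` {..<n}"
    by (simp add: unity_roots_def)
  with bij show "unity_roots n = {z. z ^ n = 1}"
    by (simp add: bij_betw_def)
  show "card (unity_roots n) = n"
    using bij_betw_same_card[OF bij] bij eq by (simp add: bij_betw_def)
qed

text \<open>Both sides have degree at most \<open>n\<close> and agree at \<open>n + 1\<close>
  points: they vanish at the roots of unity and equal 1 at 0. The extra point 0 replaces a
  comparison of leading coefficients.\<close>

lemma prod_unity_roots_poly:
  assumes "n \<ge> 1"
  shows "(\<Prod>z\<in>unity_roots n. [:1, - z:]) = 1 - monom 1 n"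
proof (rule poly_eqI_degree)
  let ?A = "insert 0 (unity_roots n)"
  note roots = unity_roots_eq[OF assms]
  have fin: "finite (unity_roots n)"
    using roots(2) assms by (metis card.infinite not_one_le_zero)
  have "0 \<notin> unity_roots n"
    using assms by (simp add: roots(1) power_0_left)
  then have card: "card ?A = Suc n"
    using fin roots(2) by simp
  show "poly (\<Prod>z\<in>unity_roots n. [:1, - z:]) x = poly (1 - monom 1 n) x" if "x \<in> ?A" for x
  proof (cases "x = 0")
    case True
    then show ?thesis using assms by (simp add: poly_prod poly_monom)
  next
    case False
    with that have x: "x ^ n = 1" by (simp add: roots(1))
    \<comment> \<open>The factor that vanishes at \<open>x\<close> is the one for
      \<open>z = inverse x\<close>.\<close>
    then have "inverse x \<in> unity_roots n" by (simp add: roots(1) power_inverse)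
    moreover have "poly [:1, - inverse x:] x = 0" using False by simp
    ultimately have "poly (\<Prod>z\<in>unity_roots n. [:1, - z:]) x = 0"
      unfolding poly_prod using fin by (metis (no_types, lifting) prod_zero)
    then show ?thesis by (simp add: x poly_monom)
  qed
  have "degree (\<Prod>z\<in>unity_roots n. [:1, - z:]) \<le> (\<Sum>z\<in>unity_roots n. degree [:1, - z:])"
    using degree_prod_sum_le[OF fin, of "\<lambda>z. [:1, - z:]"] by (simp only: o_def)
  also have "\<dots> \<le> (\<Sum>z\<in>unity_roots n. 1)"
    by (rule sum_mono) simp
  finally show "degree (\<Prod>z\<in>unity_roots n. [:1, - z:]) < card ?A"
    using card roots(2) by simp
  have "degree (1 - monom 1 n :: complex poly) \<le> n"
    by (rule degree_diff_le) (simp_all add: degree_monom_le)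
  then show "degree (1 - monom 1 n :: complex poly) < card ?A"
    using card by simp
qed

lemma prod_unity_roots_fps:
  assumes "n \<ge> 1"
  shows "(\<Prod>z\<in>unity_roots n. 1 - fps_const z * fps_X) = 1 - fps_X ^ n"
proof -
  have "fps_of_poly [:1, - z:] = 1 - fps_const z * fps_X" for z :: complex
    by (simp add: fps_of_poly_pCons fps_mult_fps_X_commute flip: fps_const_neg)
  then have "(\<Prod>z\<in>unity_roots n. 1 - fps_const z * fps_X) =
      fps_of_poly (\<Prod>z\<in>unity_roots n. [:1, - z:])"
    by (simp only: fps_of_poly_prod)
  also have "\<dots> = 1 - fps_X ^ n"
    by (simp add: prod_unity_roots_poly[OF assms] fps_of_poly_diff fps_of_poly_monom)
  finally show ?thesis .
qed

section \<open>Comparison of coefficients and reduction modulo \<open>n\<close>\<close>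

theorem theorem1p1:
  fixes n m :: nat and J :: "complex set"
  assumes "n \<ge> 1"
    and "J \<subseteq> unity_roots n"
    and "J \<noteq> {}"
  shows "complete_sym m (mset_set J) =
           (-1) ^ (m mod n) * elem_sym (m mod n) (mset_set (unity_roots n - J))"
proof -
  define Jc where "Jc = unity_roots n - J"
  define h where "h = (\<lambda>k. complete_sym k (mset_set J))"
  define e where "e = (\<lambda>k. (-1) ^ k * elem_sym k (mset_set Jc))"
  have fin: "finite (unity_roots n)"
    by (simp add: unity_roots_def)
  \<comment> \<open>Nonemptiness of \<open>J\<close> makes this inclusion strict, so that
    \<open>e\<close> vanishes already at \<open>n\<close>.\<close>
  have "Jc \<subset> unity_roots n"
    using assms(2,3) by (auto simp: Jc_def)
  then have "card Jc < n"
    using psubset_card_mono[OF fin] unity_roots_eq(2)[OF assms(1)] by simp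
  then have e_eq_0: "e k = 0" if "k \<ge> n" for k
    using that by (simp add: e_def elem_sym_eq_0)
  have "(\<Prod>z\<in>unity_roots n. 1 - fps_const z * fps_X) =
      (\<Prod>z\<in>Jc. 1 - fps_const z * fps_X) * (\<Prod>z\<in>J. 1 - fps_const z * fps_X)"
    unfolding Jc_def by (rule prod.subset_diff[OF assms(2) fin])
  also have "(\<Prod>z\<in>Jc. 1 - fps_const z * fps_X) = Abs_fps e"
    using elem_sym_generating_function[of "mset_set Jc"]
    by (simp add: prod_unfold_prod_mset e_def)
  finally have "1 - fps_X ^ n = Abs_fps e * (\<Prod>z\<in>J. 1 - fps_const z * fps_X)"
    unfolding prod_unity_roots_fps[OF assms(1)] .
  moreover have "(\<Prod>z\<in>J. 1 - fps_const z * fps_X) * Abs_fps h = 1"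
    using complete_sym_generating_function[of "mset_set J"]
    by (simp add: prod_unfold_prod_mset h_def)
  ultimately have "Abs_fps h * (1 - fps_X ^ n) = Abs_fps e"
    by (simp add: mult_ac)
  then have "fps_nth (Abs_fps h * (1 - fps_X ^ n)) k = e k" for k
    by simp
  \<comment> \<open>Multiplication by \<open>fps_X ^ n\<close> shifts the coefficients by
    \<open>n\<close> and puts zeros below; hence the case distinction.\<close>
  then have rec: "h k - (if k < n then 0 else h (k - n)) = e k" for k
    by (simp add: algebra_simps fps_X_power_mult_right_nth)
  have "h m = e (m mod n)"
  proof (induction m rule: less_induct)
    case (less m)
    show ?case
    proof (cases "m < n")
      case True
      with rec[of m] show ?thesis by simp
    next
      case False
      \<comment> \<open>Beyond the degree of the right-hand side, \<open>rec\<close> becomes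
        periodicity; \<open>n \<ge> 1\<close> makes \<open>m - n\<close> smaller than
        \<open>m\<close>.\<close>
      with rec[of m] e_eq_0[of m] have "h m = h (m - n)" by simp
      also have "\<dots> = e ((m - n) mod n)" using less False assms(1) by simp
      finally show ?thesis using False by (simp add: le_mod_geq)
    qed
  qed
  then show ?thesis
    by (simp add: h_def e_def Jc_def)
qed

end
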